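(* Let $L$ be a dextral symmetric right Leibniz algebra over a field. Then $L$ is solvable if and only if it is left nilpotent.
   Context: A right Leibniz algebra over a field $F$ is an $F$-vector space $L$ with a bilinear bracket $[\,,]:L\times L\to L$ satisfying $[a,[b,c]]=[[a,b],c]-[[a,c],b]$ for all $a,b,c\in L$. $L$ is dextral symmetric if for all $a,b,c\in L$, $[a,[b,c]]=0$ implies $[b,[a,c]]=0$. For subspaces $A,B$, $[A,B]$ is the span of all $[a,b]$ with $a\in A$, $b\in B$. Define $L^{(1)}=L$, $L^{(n+1)}=[L,L^{(n)}]$ and $L^{[1]}=L$, $L^{[n+1]}=[L^{[n]},L^{[n]}]$. $L$ is left nilpotent if $L^{(k)}=0$ for some $k\in\mathbb N$, and solvable if $L^{[k]}=0$ for some $k\in\mathbb N$. *)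

theory Defs
  imports Complex_Main
begin

text \<open>The algebra is a whole type carrying a vector space structure over the field \<open>'f\<close>;
  no assumption is made on its dimension or on the characteristic of \<open>'f\<close>.\<close>

locale right_leibniz_algebra = vector_space scale
  for scale :: "'f::field \<Rightarrow> 'a::ab_group_add \<Rightarrow> 'a" (infixr "*s" 75) +
  fixes bracket :: "'a \<Rightarrow> 'a \<Rightarrow> 'a"
  assumes bracket_linear_left: "Vector_Spaces.linear scale scale (\<lambda>a. bracket a b)"
    and bracket_linear_right: "Vector_Spaces.linear scale scale (\<lambda>b. bracket a b)"
    and right_leibniz:
      "bracket a (bracket b c) = bracket (bracket a b) c - bracket (bracket a c) b"
begin

definition dextral_symmetric :: bool where
  "dextral_symmetric \<longleftrightarrow>
    (\<forall>a b c. bracket a (bracket b c) = 0 \<longrightarrow> bracket b (bracket a c) = 0)"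

definition bracket_span :: "'a set \<Rightarrow> 'a set \<Rightarrow> 'a set" where
  "bracket_span A B = span {bracket a b | a b. a \<in> A \<and> b \<in> B}"

text \<open>Both series start at index 1; the value at index 0 is a filler and is excluded
  in the definitions of left nilpotency and solvability.\<close>

fun left_series :: "nat \<Rightarrow> 'a set" where
  "left_series 0 = UNIV"
| "left_series (Suc 0) = UNIV"
| "left_series (Suc (Suc n)) = bracket_span UNIV (left_series (Suc n))"

fun derived_series :: "nat \<Rightarrow> 'a set" where
  "derived_series 0 = UNIV"
| "derived_series (Suc 0) = UNIV"
| "derived_series (Suc (Suc n)) =
    bracket_span (derived_series (Suc n)) (derived_series (Suc n))"

definition left_nilpotent :: bool where
  "left_nilpotent \<longleftrightarrow> (\<exists>k\<ge>1. left_series k = {0})"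

definition solvable :: bool where
  "solvable \<longleftrightarrow> (\<exists>k\<ge>1. derived_series k = {0})"

end

end

(* In a dextral symmetric right Leibniz algebra the triple product [a, [b, c]] is alternating:
   the Leibniz identity gives [a, [b, b]] = 0, dextral symmetry turns this into [b, [a, b]] = 0,
   and polarisation does the rest. Moving factors with this antisymmetry yields
   L^(m+n) \<subseteq> [L^(m), L^(n)] for n \<ge> 2, hence L^(2^k) \<subseteq> L^[k+1], so a solvable algebra is
   left nilpotent. Conversely L^[n] \<subseteq> L^(n) holds in every right Leibniz algebra. *)
theory Submission
  imports Defs
begin

context right_leibniz_algebra
begin

lemma bracket_zero_right [simp]: "bracket a 0 = 0"
  by (rule module_hom.zero[OF bracket_linear_right[unfolded linear_iff_module_hom]])

lemma bracket_add_left: "bracket (a + b) c = bracket a c + bracket b c"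
  by (rule module_hom.add[OF bracket_linear_left[unfolded linear_iff_module_hom]])

lemma bracket_add_right: "bracket a (b + c) = bracket a b + bracket a c"
  by (rule module_hom.add[OF bracket_linear_right[unfolded linear_iff_module_hom]])

lemma bracket_scale_right: "bracket a (r *s b) = r *s bracket a b"
  by (rule module_hom.scale[OF bracket_linear_right[unfolded linear_iff_module_hom]])

lemma bracket_in_span: "a \<in> A \<Longrightarrow> b \<in> B \<Longrightarrow> bracket a b \<in> bracket_span A B"
  unfolding bracket_span_def by (rule span_base) blast

lemma subspace_bracket_span: "subspace (bracket_span A B)"
  unfolding bracket_span_def by (rule subspace_span)

lemma bracket_span_least:
  assumes "subspace S" and "\<And>a b. a \<in> A \<Longrightarrow> b \<in> B \<Longrightarrow> bracket a b \<in> S"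
  shows "bracket_span A B \<subseteq> S"
  unfolding bracket_span_def by (rule span_minimal) (use assms in auto)

lemma bracket_span_mono: "A \<subseteq> A' \<Longrightarrow> B \<subseteq> B' \<Longrightarrow> bracket_span A B \<subseteq> bracket_span A' B'"
  by (rule bracket_span_least[OF subspace_bracket_span]) (blast intro: bracket_in_span)

text \<open>Lets a membership \<open>bracket a z \<in> S\<close> checked on generating brackets
  \<open>z\<close> pass to their whole span.\<close>

lemma subspace_bracket_right_vimage: "subspace S \<Longrightarrow> subspace {z. bracket a z \<in> S}"
  by (auto simp: subspace_def bracket_add_right bracket_scale_right)

lemma left_series_Suc: "n \<ge> 1 \<Longrightarrow> left_series (Suc n) = bracket_span UNIV (left_series n)"
  by (cases n) auto

lemma derived_series_Suc:
  "n \<ge> 1 \<Longrightarrow> derived_series (Suc n) = bracket_span (derived_series n) (derived_series n)"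
  by (cases n) auto

lemma subspace_left_series: "subspace (left_series n)"
  by (cases n rule: left_series.cases) (auto simp: subspace_bracket_span)

lemma subspace_derived_series: "subspace (derived_series n)"
  by (cases n rule: derived_series.cases) (auto simp: subspace_bracket_span)

text \<open>By induction: the left factor is enlarged to \<open>UNIV\<close>, the right one by the
  induction hypothesis.\<close>

lemma derived_series_subset_left_series: "derived_series n \<subseteq> left_series n"
proof (induction n rule: left_series.induct)
  case (3 n)
  then show ?case
    unfolding left_series.simps derived_series.simps by (intro bracket_span_mono) auto
qed auto

lemma left_nilpotent_imp_solvable: "left_nilpotent \<Longrightarrow> solvable"
  unfolding left_nilpotent_def solvable_def
  using derived_series_subset_left_series subspace_0[OF subspace_derived_series] by blast

text \<open>The right-hand side of the Leibniz identity changes sign when \<open>b\<close> and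
  \<open>c\<close> are exchanged.\<close>

lemma triple_swap_last: "bracket a (bracket b c) = - bracket a (bracket c b)"
  using right_leibniz[of a b c] right_leibniz[of a c b] by simp

context
  assumes dextral: dextral_symmetric
begin

lemma triple_swap_outer: "bracket a (bracket b c) = - bracket c (bracket b a)"
proof -
  have alt: "bracket x (bracket b x) = 0" for x
    using dextral right_leibniz[of b x x] by (simp add: dextral_symmetric_def)
  show ?thesis
    using alt[of "a + c"] alt[of a] alt[of c]
    by (simp add: bracket_add_left bracket_add_right add_eq_0_iff2)
qed

text \<open>This transposition is a composition of three: last, outer, last.\<close>

lemma triple_swap_first: "bracket a (bracket b c) = - bracket b (bracket a c)"
  using triple_swap_last[of a b c] triple_swap_outer[of a c b] triple_swap_last[of b c a] by simp

lemma triple_rotate: "bracket a (bracket b c) = bracket b (bracket c a)"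
  using triple_swap_first[of a b c] triple_swap_last[of b a c] by simp

text \<open>Induction on \<open>n\<close>, moving outer factors into the second argument. It starts
  at 2 because the antisymmetry concerns triple products only and gives no way to swap the factors
  of a single bracket.\<close>

lemma left_series_add_subset:
  assumes m: "m \<ge> 1" and n: "n \<ge> 2"
  shows "left_series (m + n) \<subseteq> bracket_span (left_series m) (left_series n)"
  using n
proof (induction n rule: dec_induct)
  case base
  let ?S = "bracket_span (left_series m) (left_series 2)"
  have "bracket a z \<in> ?S" if "z \<in> left_series (Suc m)" for a z
  proof -
    have "bracket a (bracket b x) \<in> ?S" if "x \<in> left_series m" for b x
      \<comment> \<open>Rotation rewrites the product as \<open>bracket x (bracket a b)\<close>,
        whose inner bracket lies in \<open>left_series 2\<close>.\<close>
      using that unfolding triple_rotate[of x a b, symmetric]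
      by (intro bracket_in_span) (auto simp: numeral_2_eq_2 intro!: bracket_in_span)
    then have "left_series (Suc m) \<subseteq> {z. bracket a z \<in> ?S}"
      unfolding left_series_Suc[OF m]
      by (intro bracket_span_least subspace_bracket_right_vimage subspace_bracket_span) auto
    with that show ?thesis by blast
  qed
  then show ?case
    using m bracket_span_least[OF subspace_bracket_span, of UNIV "left_series (Suc m)"]
    by (simp add: left_series_Suc)
next
  case (step n)
  let ?S = "bracket_span (left_series m) (left_series (Suc n))"
  have "bracket a z \<in> ?S" if "z \<in> left_series (m + n)" for a z
  proof -
    have "bracket a (bracket x y) \<in> ?S" if "x \<in> left_series m" "y \<in> left_series n" for x y
    proof -
      \<comment> \<open>Up to sign, \<open>a\<close> moves past \<open>x\<close> and is absorbed by
        \<open>y\<close>, which raises the second index by one.\<close>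
      have "bracket a y \<in> left_series (Suc n)"
        using that step by (simp add: left_series_Suc bracket_in_span)
      then show ?thesis
        using that triple_swap_first[of a x y] 
        by (simp add: bracket_in_span subspace_neg subspace_bracket_span)
    qed
    then have "bracket_span (left_series m) (left_series n) \<subseteq> {z. bracket a z \<in> ?S}"
      by (intro bracket_span_least subspace_bracket_right_vimage subspace_bracket_span) auto
    with that step.IH show ?thesis by blast
  qed
  then show ?case
    using m bracket_span_least[OF subspace_bracket_span, of UNIV "left_series (m + n)"]
    by (simp add: left_series_Suc)
qed

text \<open>Each derived step brackets a term with itself, so the left index doubles:
  \<open>left_series_add_subset\<close> is used with both indices equal to
  \<open>2 ^ k\<close>.\<close>

lemma left_series_subset_derived_series: "left_series (2 ^ k) \<subseteq> derived_series (Suc k)"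
proof (induction k)
  case 0
  show ?case by simp
next
  case (Suc k)
  show ?case
  \<comment> \<open>For \<open>k = 0\<close> the second index would be 1, below the required 2;
    there both sides are the span of all brackets.\<close>
  proof (cases "k = 0")
    case True
    then show ?thesis by (simp add: numeral_2_eq_2)
  next
    case False
    then have "(2::nat) ^ 1 \<le> 2 ^ k"
      by (intro power_increasing) auto
    then have "left_series (2 ^ k + 2 ^ k)
        \<subseteq> bracket_span (left_series (2 ^ k)) (left_series (2 ^ k))"
      by (intro left_series_add_subset) auto
    also have "\<dots> \<subseteq> derived_series (Suc (Suc k))"
      using bracket_span_mono[OF Suc Suc] by simp
    finally show ?thesis by (simp add: mult_2)
  qed
qed

lemma solvable_imp_left_nilpotent:
  assumes solvable
  shows left_nilpotent
proof -
  obtain k where "k \<ge> 1" "derived_series k = {0}"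
    using assms by (auto simp: solvable_def)
  \<comment> \<open>Since \<open>k \<ge> 1\<close>, \<open>Suc (k - 1)\<close> is
    \<open>k\<close>.\<close>
  then have "left_series (2 ^ (k - 1)) \<subseteq> {0}"
    using left_series_subset_derived_series[of "k - 1"] by simp
  then have "left_series (2 ^ (k - 1)) = {0}"
    using subspace_0[OF subspace_left_series] by blast
  then show ?thesis
    unfolding left_nilpotent_def by (intro exI[of _ "2 ^ (k - 1)"]) simp
qed

end

end

theorem theorem4p11:
  fixes scale :: "'f::field \<Rightarrow> 'a::ab_group_add \<Rightarrow> 'a"
    and bracket :: "'a \<Rightarrow> 'a \<Rightarrow> 'a"
  assumes "right_leibniz_algebra scale bracket"
    and "right_leibniz_algebra.dextral_symmetric bracket"
  shows "right_leibniz_algebra.solvable scale bracket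
    \<longleftrightarrow> right_leibniz_algebra.left_nilpotent scale bracket"
  using assms right_leibniz_algebra.solvable_imp_left_nilpotent
    right_leibniz_algebra.left_nilpotent_imp_solvable by blast

end
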